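(* Let $t$ be a positive integer and let $G$ be a finite graph. If $\mathrm{zig}(G)\ge t$, then $G$ contains the complete graph $K_{\lfloor t/2\rfloor+1}$ as an odd-minor.
   Context: All graphs are finite and simple. A proper coloring of $G$ is a map $c:V(G)\to\mathbb{N}$ with $c(u)\neq c(v)$ for every edge $uv$. Given a proper coloring $c$ of $G$, a zigzag of length $k$ in $(G,c)$ is a sequence of vertices $z_1,\dots,z_k\in V(G)$ with $c(z_1)<c(z_2)<\cdots<c(z_k)$ such that every vertex of $\{z_i: i \text{ odd}\}$ is adjacent to every vertex of $\{z_i: i\text{ even}\}$ (i.e. these two sets form the sides of a complete bipartite subgraph). The zig-zag number $\mathrm{zig}(G)$ is the minimum, over all proper colorings $c$ of $G$, of the maximum length of a zigzag in $(G,c)$. A graph $G$ contains $H$ as an odd-minor if a graph isomorphic to $H$ can be obtained from some subgraph $G'\subseteq G$ by choosing an edge-cut of $G'$ (the set of edges between $S$ and $V(G')\setminus S$ for some $S\subseteq V(G')$) and contracting all edges of this cut simultaneously. *)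

theory Defs
  imports "Graph_Theory.Graph_Theory"
begin

text \<open>
  A finite simple graph is a \<^locale>\<open>pair_graph\<close>: an undirected edge \<open>uv\<close> is represented by the two
  arcs \<open>(u, v)\<close> and \<open>(v, u)\<close>.
\<close>

definition proper_coloring :: "'a pair_pre_digraph \<Rightarrow> ('a \<Rightarrow> nat) \<Rightarrow> bool" where
  "proper_coloring G c \<longleftrightarrow> (\<forall>(u, v) \<in> parcs G. c u \<noteq> c v)"

definition zigzag :: "'a pair_pre_digraph \<Rightarrow> ('a \<Rightarrow> nat) \<Rightarrow> nat \<Rightarrow> (nat \<Rightarrow> 'a) \<Rightarrow> bool" where
  "zigzag G c k z \<longleftrightarrow>
     (\<forall>i\<in>{1..k}. z i \<in> pverts G) \<and>
     strict_mono_on {1..k} (\<lambda>i. c (z i)) \<and>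
     (\<forall>i\<in>{1..k}. \<forall>j\<in>{1..k}. odd i \<and> even j \<longrightarrow> (z i, z j) \<in> parcs G)"

text \<open>
  The empty sequence counts as a zigzag of length 0, so the maximum below is also defined for the
  graph without vertices.
\<close>

definition max_zigzag :: "'a pair_pre_digraph \<Rightarrow> ('a \<Rightarrow> nat) \<Rightarrow> nat" where
  "max_zigzag G c = Max {k. \<exists>z. zigzag G c k z}"

definition zig :: "'a pair_pre_digraph \<Rightarrow> nat" where
  "zig G = (LEAST m. \<exists>c. proper_coloring G c \<and> m = max_zigzag G c)"

definition cut_arcs :: "'a pair_pre_digraph \<Rightarrow> 'a set \<Rightarrow> ('a \<times> 'a) set" where
  "cut_arcs G S = {(u, v) \<in> parcs G. u \<in> S \<longleftrightarrow> v \<notin> S}"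

text \<open>
  Simultaneous contraction of a symmetric set \<open>F\<close> of arcs of \<open>G\<close>: then \<open>F\<^sup>*\<close> is an equivalence
  relation, whose classes on the vertices of \<open>G\<close> are the components of the spanning subgraph with
  arc set \<open>F\<close>. Loops and parallel edges that arise are discarded.
\<close>

definition contract :: "'a pair_pre_digraph \<Rightarrow> ('a \<times> 'a) set \<Rightarrow> 'a set pair_pre_digraph" where
  "contract G F =
     \<lparr> pverts = pverts G // F\<^sup>*,
       parcs = {(A, B). A \<in> pverts G // F\<^sup>* \<and> B \<in> pverts G // F\<^sup>* \<and> A \<noteq> B \<and>
                        (\<exists>u\<in>A. \<exists>v\<in>B. (u, v) \<in> parcs G)} \<rparr>"

definition odd_minor :: "'b pair_pre_digraph \<Rightarrow> 'a pair_pre_digraph \<Rightarrow> bool" where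
  "odd_minor H G \<longleftrightarrow>
     (\<exists>G' S. pair_graph G' \<and> subgraph (with_proj G') (with_proj G) \<and> S \<subseteq> pverts G' \<and>
             digraph_iso (with_proj (contract G' (cut_arcs G' S))) (with_proj H))"

definition complete_graph :: "nat \<Rightarrow> nat pair_pre_digraph" where
  "complete_graph n = \<lparr> pverts = {..<n}, parcs = {(u, v). u < n \<and> v < n \<and> u \<noteq> v} \<rparr>"

lemma complete_digraph_complete_graph: "complete_digraph n (with_proj (complete_graph n))"
  by (auto simp: complete_digraph_pair_def complete_graph_def)

lemma zigzag_0: "zigzag G c 0 z"
  by (simp add: zigzag_def strict_mono_on_def)

lemma zigzag_le_card:
  assumes "pair_graph G" "zigzag G c k z"
  shows "k \<le> card (pverts G)"
proof -
  interpret pair_graph G by fact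
  have "inj_on (\<lambda>i. c (z i)) {1..k}"
    using assms(2) unfolding zigzag_def by (blast intro: strict_mono_on_imp_inj_on)
  then have "inj_on z {1..k}"
    unfolding inj_on_def by metis
  moreover have "z ` {1..k} \<subseteq> pverts G"
    using assms(2) unfolding zigzag_def by blast
  ultimately show ?thesis
    using card_inj_on_le[OF _ _ pair_finite_verts, of z "{1..k}"] by simp
qed

lemma finite_zigzag_lengths:
  assumes "pair_graph G"
  shows "finite {k. \<exists>z. zigzag G c k z}"
proof (rule finite_subset)
  show "{k. \<exists>z. zigzag G c k z} \<subseteq> {..card (pverts G)}"
    using zigzag_le_card[OF assms] by blast
qed simp

lemma ex_proper_coloring:
  assumes "pair_graph G"
  shows "\<exists>c. proper_coloring G c"
proof -
  interpret pair_graph G by fact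
  obtain c :: "'a \<Rightarrow> nat" where c: "inj_on c (pverts G)"
    using finite_imp_inj_to_nat_seg[OF pair_finite_verts] by blast
  have "c u \<noteq> c v" if "(u, v) \<in> parcs G" for u v
    using inj_onD[OF c, of u v] in_arcsD1[OF that] in_arcsD2[OF that] pair_no_loops[OF that]
    by force
  then show ?thesis
    unfolding proper_coloring_def by blast
qed

lemma zig_attained:
  assumes "pair_graph G"
  shows "\<exists>c. proper_coloring G c \<and> zig G = max_zigzag G c"
proof -
  obtain c where "proper_coloring G c"
    using ex_proper_coloring[OF assms] by blast
  then have "\<exists>c'. proper_coloring G c' \<and> max_zigzag G c = max_zigzag G c'"
    by blast
  then show ?thesis
    unfolding zig_def by (rule LeastI)
qed

lemma zig_le:
  assumes "proper_coloring G c"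
  shows "zig G \<le> max_zigzag G c"
  unfolding zig_def by (rule Least_le) (use assms in blast)

end

(*
  Colour G by repeatedly deleting a maximal connected induced bipartite subgraph K and giving its
  two sides two new colours, larger than all earlier ones. By maximality, a vertex deleted later
  that has a neighbour in K has neighbours on both sides of K.

  A zigzag meets each K in at most two, necessarily consecutive, terms. Reading it from its last
  term back, one builds disjoint trees, 2-coloured by signs, any two of which are joined by an edge
  with equal signs at its ends: this is an odd-minor model of a complete graph. A K met twice
  becomes a new tree, since it is adjacent, with both signs, to every later term. A K met once is
  adjacent to all later terms of the other index parity. It either becomes a new tree or is merged
  with a tree that has terms of that other parity only.
*)
theory Submission
  imports Defs
begin

section \<open>Signed trees\<close>

definition cut_within :: "('a \<times> 'a) set \<Rightarrow> ('a \<Rightarrow> bool) \<Rightarrow> 'a set \<Rightarrow> ('a \<times> 'a) set" where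
  "cut_within E \<sigma> B = {(u, v) \<in> E. u \<in> B \<and> v \<in> B \<and> \<sigma> u \<noteq> \<sigma> v}"

text \<open>For symmetric \<open>E\<close> and finite nonempty \<open>B\<close> this says that
  \<open>B\<close> has a spanning tree all of whose edges change sign. Arcs inside \<open>B\<close>
  with equal signs are allowed; contracting the sign-changing arcs collapses \<open>B\<close> to one
  vertex.\<close>

definition cut_connected :: "('a \<times> 'a) set \<Rightarrow> ('a \<Rightarrow> bool) \<Rightarrow> 'a set \<Rightarrow> bool" where
  "cut_connected E \<sigma> B \<longleftrightarrow> (\<forall>u\<in>B. \<forall>v\<in>B. (u, v) \<in> (cut_within E \<sigma> B)\<^sup>*)"

text \<open>An odd-minor model of a complete graph with branch sets \<B>. An arc with equal signs
  stays outside the cut given by \<sigma>, so it survives the contraction as an adjacency. The empty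
  set is excluded explicitly because it is vacuously cut-connected.\<close>

definition odd_clique :: "('a \<times> 'a) set \<Rightarrow> ('a \<Rightarrow> bool) \<Rightarrow> 'a set set \<Rightarrow> bool" where
  "odd_clique E \<sigma> \<B> \<longleftrightarrow>
     disjoint \<B> \<and> {} \<notin> \<B> \<and> (\<forall>B\<in>\<B>. cut_connected E \<sigma> B) \<and>
     (\<forall>A\<in>\<B>. \<forall>B\<in>\<B>. A \<noteq> B \<longrightarrow> (\<exists>u\<in>A. \<exists>v\<in>B. (u, v) \<in> E \<and> \<sigma> u = \<sigma> v))"

text \<open>Only the signs on \<open>K\<close> enter. Whatever sign \<open>v\<close> receives, it
  has a neighbour in \<open>K\<close> of equal sign, which links two branch sets, and one of
  opposite sign, which allows merging them.\<close>

definition joined_to_both_sides :: "('a \<times> 'a) set \<Rightarrow> ('a \<Rightarrow> bool) \<Rightarrow> 'a set \<Rightarrow> 'a \<Rightarrow> bool" where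
  "joined_to_both_sides E \<sigma> K v \<longleftrightarrow> (\<forall>s. \<exists>w\<in>K. \<sigma> w = s \<and> (w, v) \<in> E)"

lemma cut_connected_singleton: "cut_connected E \<sigma> {v}"
  by (simp add: cut_connected_def)

lemma cut_connected_cong:
  assumes "\<And>x. x \<in> B \<Longrightarrow> \<sigma> x = \<tau> x"
  shows "cut_connected E \<sigma> B = cut_connected E \<tau> B"
proof -
  have "cut_within E \<sigma> B = cut_within E \<tau> B"
    using assms by (auto simp: cut_within_def)
  then show ?thesis
    by (simp add: cut_connected_def)
qed

text \<open>Every vertex of the union reaches \<open>u\<close>: those of \<open>A\<close> within
  \<open>A\<close>, those of \<open>B\<close> through the sign-changing arc between \<open>u\<close>
  and \<open>v\<close>. Symmetry then connects any two vertices.\<close>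

lemma cut_connected_Un:
  assumes E: "sym E" and A: "cut_connected E \<sigma> A" and B: "cut_connected E \<sigma> B"
    and uv: "u \<in> A" "v \<in> B" "(u, v) \<in> E" "\<sigma> u \<noteq> \<sigma> v"
  shows "cut_connected E \<sigma> (A \<union> B)"
proof -
  let ?F = "cut_within E \<sigma> (A \<union> B)"
  have mono: "(cut_within E \<sigma> A)\<^sup>* \<subseteq> ?F\<^sup>*" "(cut_within E \<sigma> B)\<^sup>* \<subseteq> ?F\<^sup>*"
    by (intro rtrancl_mono; auto simp: cut_within_def)+
  have edge: "(u, v) \<in> ?F"
    using uv by (auto simp: cut_within_def)
  have "sym ?F"
    using E by (auto simp: cut_within_def sym_def)
  then have sym: "sym (?F\<^sup>*)"
    by (rule sym_rtrancl)
  have "(x, u) \<in> ?F\<^sup>*" if "x \<in> A \<union> B" for x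
  proof (cases "x \<in> A")
    case True
    then show ?thesis
      using A uv(1) mono(1) unfolding cut_connected_def by blast
  next
    case False
    then have "(v, x) \<in> ?F\<^sup>*"
      using B uv(2) mono(2) that unfolding cut_connected_def by blast
    then have "(u, x) \<in> ?F\<^sup>*"
      using edge by (rule converse_rtrancl_into_rtrancl[rotated])
    then show ?thesis
      using sym by (rule symD[rotated])
  qed
  then show ?thesis
    unfolding cut_connected_def using sym by (meson rtrancl_trans symD)
qed

lemma odd_clique_cong:
  assumes "\<And>x. x \<in> \<Union>\<B> \<Longrightarrow> \<sigma> x = \<tau> x" and "odd_clique E \<sigma> \<B>"
  shows "odd_clique E \<tau> \<B>"
proof -
  have "cut_connected E \<tau> B" if "B \<in> \<B>" for B
    using assms that cut_connected_cong[of B \<sigma> \<tau> E] by (auto simp: odd_clique_def)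
  moreover have "\<exists>u\<in>A. \<exists>v\<in>B. (u, v) \<in> E \<and> \<tau> u = \<tau> v"
    if AB: "A \<in> \<B>" "B \<in> \<B>" "A \<noteq> B" for A B
  proof -
    obtain u v where "u \<in> A" "v \<in> B" "(u, v) \<in> E" "\<sigma> u = \<sigma> v"
      using assms(2) AB unfolding odd_clique_def by blast
    then show ?thesis
      using assms(1) AB by (metis UnionI)
  qed
  ultimately show ?thesis
    using assms(2) by (simp add: odd_clique_def)
qed

text \<open>A vertex of \<open>B\<close> that sees both signs in \<open>K\<close> sees its own sign
  there, and this gives the equal-sign arc between \<open>K\<close> and \<open>B\<close>.\<close>

lemma odd_clique_insert:
  assumes E: "sym E" and \<B>: "odd_clique E \<sigma> \<B>" and K: "cut_connected E \<sigma> K" "K \<noteq> {}"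
    and disj: "K \<inter> \<Union>\<B> = {}"
    and joined: "\<And>B. B \<in> \<B> \<Longrightarrow> \<exists>v\<in>B. joined_to_both_sides E \<sigma> K v"
  shows "odd_clique E \<sigma> (insert K \<B>)"
proof -
  have KB: "\<exists>u\<in>K. \<exists>v\<in>B. (u, v) \<in> E \<and> (v, u) \<in> E \<and> \<sigma> u = \<sigma> v" if "B \<in> \<B>" for B
    using joined[OF that] E unfolding joined_to_both_sides_def by (meson symD)
  have "disjoint (insert K \<B>)"
    using \<B> disj by (auto simp: odd_clique_def pairwise_insert disjnt_def)
  moreover have "\<exists>u\<in>A. \<exists>v\<in>B. (u, v) \<in> E \<and> \<sigma> u = \<sigma> v"
    if AB: "A \<in> insert K \<B>" "B \<in> insert K \<B>" "A \<noteq> B" for A B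
  proof -
    consider "A = K" "B \<in> \<B>" | "B = K" "A \<in> \<B>" | "A \<in> \<B>" "B \<in> \<B>"
      using AB by blast
    then show ?thesis
    proof cases
      case 1
      then show ?thesis using KB by blast
    next
      case 2
      then show ?thesis using KB[of A] by metis
    next
      case 3
      then show ?thesis using \<B> AB(3) unfolding odd_clique_def by blast
    qed
  qed
  ultimately show ?thesis
    using \<B> K by (simp add: odd_clique_def)
qed

text \<open>Now the neighbour of opposite sign is used: the sign-changing arc fuses \<open>K\<close>
  with \<open>B\<close>. The union inherits the links of \<open>B\<close>, so \<open>K\<close> may
  be far from all other members.\<close>

lemma odd_clique_merge:
  assumes E: "sym E" and \<B>: "odd_clique E \<sigma> \<B>" and K: "cut_connected E \<sigma> K"
    and disj: "K \<inter> \<Union>\<B> = {}" and B: "B \<in> \<B>"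
    and joined: "\<exists>v\<in>B. joined_to_both_sides E \<sigma> K v"
  shows "odd_clique E \<sigma> (insert (K \<union> B) (\<B> - {B}))"
proof -
  obtain v w where vw: "v \<in> B" "w \<in> K" "(w, v) \<in> E" "\<sigma> w \<noteq> \<sigma> v"
    using joined unfolding joined_to_both_sides_def by metis
  have conn: "cut_connected E \<sigma> (K \<union> B)"
    using cut_connected_Un[OF E K _ vw(2,1,3,4)] \<B> B by (auto simp: odd_clique_def)
  have "disjoint (insert (K \<union> B) (\<B> - {B}))"
  proof -
    have dis: "disjoint \<B>"
      using \<B> by (simp add: odd_clique_def)
    have "disjnt (K \<union> B) C \<and> disjnt C (K \<union> B)" if "C \<in> \<B> - {B}" for C
    proof -
      have "disjnt B C"
        using dis B that by (auto dest: pairwiseD)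
      then show ?thesis
        using disj that by (auto simp: disjnt_def)
    qed
    moreover have "disjoint (\<B> - {B})"
      using dis by (rule pairwise_subset) auto
    ultimately show ?thesis
      by (simp add: pairwise_insert)
  qed
  moreover have "\<exists>u\<in>A. \<exists>v\<in>C. (u, v) \<in> E \<and> \<sigma> u = \<sigma> v"
    if AC: "A \<in> insert (K \<union> B) (\<B> - {B})" "C \<in> insert (K \<union> B) (\<B> - {B})" "A \<noteq> C" for A C
  proof -
    \<comment> \<open>\<open>r\<close> sends the merged set back to the old member \<open>B\<close>,
      so that the links of the old clique can be reused.\<close>
    define r where "r X = (if X = K \<union> B then B else X)" for X
    have r: "r A \<in> \<B>" "r C \<in> \<B>" "r A \<noteq> r C" "r A \<subseteq> A" "r C \<subseteq> C"
      using AC B by (auto simp: r_def)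
    then show ?thesis
      using \<B> unfolding odd_clique_def by (meson subsetD)
  qed
  ultimately show ?thesis
    using \<B> conn vw by (auto simp: odd_clique_def)
qed

section \<open>Maximal connected induced bipartite subgraphs\<close>

text \<open>If an outside vertex \<open>v\<close> adjacent to \<open>K\<close> saw no vertex of sign
  \<open>s\<close> in \<open>K\<close>, then giving \<open>v\<close> the sign \<open>s\<close> would
  make \<open>K \<union> {v}\<close> a larger connected bipartite set.\<close>

lemma ex_maximal_connected_bipartite:
  assumes V: "finite V" "V \<noteq> {}" and E: "sym E" "irrefl E"
  obtains K \<sigma> where "K \<subseteq> V" "K \<noteq> {}" "cut_connected E \<sigma> K"
    "\<And>u v. u \<in> K \<Longrightarrow> v \<in> K \<Longrightarrow> (u, v) \<in> E \<Longrightarrow> \<sigma> u \<noteq> \<sigma> v"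
    "\<And>u v. v \<in> V - K \<Longrightarrow> u \<in> K \<Longrightarrow> (u, v) \<in> E \<Longrightarrow> joined_to_both_sides E \<sigma> K v"
proof -
  define P where "P K \<sigma> \<longleftrightarrow> K \<subseteq> V \<and> K \<noteq> {} \<and> cut_connected E \<sigma> K \<and>
      (\<forall>u\<in>K. \<forall>v\<in>K. (u, v) \<in> E \<longrightarrow> \<sigma> u \<noteq> \<sigma> v)" for K \<sigma>
  obtain v0 where "v0 \<in> V"
    using V by blast
  then have "P {v0} (\<lambda>_. True)"
    using E(2) by (auto simp: P_def cut_connected_singleton irrefl_def)
  then have "{K. \<exists>\<sigma>. P K \<sigma>} \<noteq> {}"
    by blast
  moreover have "finite {K. \<exists>\<sigma>. P K \<sigma>}"
    by (rule finite_subset[of _ "Pow V"]) (use V in \<open>auto simp: P_def\<close>)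
  \<comment> \<open>Maximality ranges over all sets that admit some signing, so a competitor of
    \<open>K\<close> may carry signs different from \<sigma>.\<close>
  ultimately have "\<exists>K\<in>{K. \<exists>\<sigma>. P K \<sigma>}. \<forall>L\<in>{K. \<exists>\<sigma>. P K \<sigma>}. K \<subseteq> L \<longrightarrow> K = L"
    by (intro finite_has_maximal)
  then obtain K \<sigma> where \<sigma>: "P K \<sigma>" and max: "\<And>L \<tau>. P L \<tau> \<Longrightarrow> K \<subseteq> L \<Longrightarrow> K = L"
    unfolding mem_Collect_eq Ball_def Bex_def by metis
  have "joined_to_both_sides E \<sigma> K v" if v: "v \<in> V - K" and u: "u \<in> K" "(u, v) \<in> E" for u v
  proof (rule ccontr)
    assume "\<not> ?thesis"
    then obtain s where s: "\<And>w. w \<in> K \<Longrightarrow> (w, v) \<in> E \<Longrightarrow> \<sigma> w \<noteq> s"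
      unfolding joined_to_both_sides_def by blast
    define \<tau> where "\<tau> = \<sigma>(v := s)"
    have \<tau>: "\<tau> x = \<sigma> x" if "x \<in> K" for x
      using v that by (auto simp: \<tau>_def)
    have "cut_connected E \<tau> K"
      using \<sigma> cut_connected_cong[of K \<tau> \<sigma>, OF \<tau>] by (simp add: P_def)
    moreover have "\<tau> u \<noteq> \<tau> v"
      using s[OF u] \<tau>[OF u(1)] by (simp add: \<tau>_def)
    ultimately have "cut_connected E \<tau> (K \<union> {v})"
      by (intro cut_connected_Un[OF E(1) _ cut_connected_singleton u(1) _ u(2)]) auto
    moreover have "\<tau> x \<noteq> \<tau> y" if xy: "x \<in> K \<union> {v}" "y \<in> K \<union> {v}" "(x, y) \<in> E" for x y
    proof -
      have yx: "(y, x) \<in> E"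
        using E(1) xy(3) by (rule symD)
      consider "x \<in> K" "y \<in> K" | "x \<in> K" "y = v" | "x = v" "y \<in> K" | "x = v" "y = v"
        using xy by blast
      then show ?thesis
      proof cases
        case 1
        then show ?thesis using \<tau> \<sigma> xy(3) by (auto simp: P_def)
      next
        case 2
        then show ?thesis using s[of x] xy(3) \<tau>[of x] by (simp add: \<tau>_def)
      next
        case 3
        then show ?thesis using s[of y] yx \<tau>[of y] by (simp add: \<tau>_def)
      next
        case 4
        then show ?thesis using E(2) xy(3) by (simp add: irrefl_def)
      qed
    qed
    ultimately have "P (K \<union> {v}) \<tau>"
      using \<sigma> v by (auto simp: P_def)
    then show False
      using max[of "K \<union> {v}" \<tau>] v by blast
  qed
  then show thesis
    using that[of K \<sigma>] \<sigma> by (auto simp: P_def)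
qed

section \<open>Odd cliques from zigzags\<close>

text \<open>Terms keep their original indices, so index parities are unaffected when initial terms
  are removed.\<close>

definition zigzag_on ::
    "'a set \<Rightarrow> ('a \<times> 'a) set \<Rightarrow> ('a \<Rightarrow> nat) \<Rightarrow> nat \<Rightarrow> nat \<Rightarrow> (nat \<Rightarrow> 'a) \<Rightarrow> bool" where
  "zigzag_on V E c a b z \<longleftrightarrow>
     (\<forall>i\<in>{a..b}. z i \<in> V) \<and>
     strict_mono_on {a..b} (\<lambda>i. c (z i)) \<and>
     (\<forall>i\<in>{a..b}. \<forall>j\<in>{a..b}. odd i \<noteq> odd j \<longrightarrow> (z i, z j) \<in> E)"

text \<open>The value \<open>True\<close> of \<open>p\<close> stands for odd indices.\<close>

definition meets :: "(nat \<Rightarrow> 'a) \<Rightarrow> nat \<Rightarrow> nat \<Rightarrow> bool \<Rightarrow> 'a set \<Rightarrow> bool" where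
  "meets z a b p B \<longleftrightarrow> (\<exists>i\<in>{a..b}. odd i = p \<and> z i \<in> B)"

text \<open>The invariant of the backward reading. With \<open>b + 1 - a\<close> odd there is one
  exceptional set, guaranteed to contain only a term of the common parity of \<open>a\<close> and
  \<open>b\<close>; with \<open>b + 1 - a\<close> even there are two, one for each parity. All other
  members have terms of both parities. This records which members a piece containing the preceding
  term can be joined to.\<close>

definition zigzag_clique ::
    "'a set \<Rightarrow> ('a \<times> 'a) set \<Rightarrow> nat \<Rightarrow> nat \<Rightarrow> (nat \<Rightarrow> 'a) \<Rightarrow> ('a \<Rightarrow> bool) \<Rightarrow> 'a set set \<Rightarrow> bool" where
  "zigzag_clique V E a b z \<sigma> \<B> \<longleftrightarrow>
     finite \<B> \<and> \<Union>\<B> \<subseteq> V \<and> odd_clique E \<sigma> \<B> \<and> card \<B> = (b + 1 - a) div 2 + 1 \<and>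
     (\<exists>B\<^sub>1\<in>\<B>. \<exists>B\<^sub>2\<in>\<B>. (B\<^sub>1 = B\<^sub>2 \<longleftrightarrow> odd a = odd b) \<and>
        meets z a b (odd a) B\<^sub>1 \<and> meets z a b (odd b) B\<^sub>2 \<and>
        (\<forall>B\<in>\<B> - {B\<^sub>1, B\<^sub>2}. \<forall>p. meets z a b p B))"

lemma zigzag_cliqueI:
  assumes "finite \<B>" "\<Union>\<B> \<subseteq> V" "odd_clique E \<sigma> \<B>" "card \<B> = (b + 1 - a) div 2 + 1"
    and "B\<^sub>1 \<in> \<B>" "B\<^sub>2 \<in> \<B>" "B\<^sub>1 = B\<^sub>2 \<longleftrightarrow> odd a = odd b"
    and "meets z a b (odd a) B\<^sub>1" "meets z a b (odd b) B\<^sub>2"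
    and "\<And>B p. B \<in> \<B> - {B\<^sub>1, B\<^sub>2} \<Longrightarrow> meets z a b p B"
  shows "zigzag_clique V E a b z \<sigma> \<B>"
  unfolding zigzag_clique_def using assms(1-4)
  by (intro conjI bexI[OF _ assms(5)] bexI[OF _ assms(6)] assms(7-9)) (auto intro!: assms(10))

lemma zigzag_cliqueE:
  assumes "zigzag_clique V E a b z \<sigma> \<B>"
  obtains B\<^sub>1 B\<^sub>2 where "B\<^sub>1 \<in> \<B>" "B\<^sub>2 \<in> \<B>" "B\<^sub>1 = B\<^sub>2 \<longleftrightarrow> odd a = odd b"
    "meets z a b (odd a) B\<^sub>1" "meets z a b (odd b) B\<^sub>2"
    "\<And>B p. B \<in> \<B> - {B\<^sub>1, B\<^sub>2} \<Longrightarrow> meets z a b p B"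
proof -
  from assms obtain B\<^sub>1 B\<^sub>2 where "B\<^sub>1 \<in> \<B>" "B\<^sub>2 \<in> \<B>" and
    B: "(B\<^sub>1 = B\<^sub>2 \<longleftrightarrow> odd a = odd b) \<and> meets z a b (odd a) B\<^sub>1 \<and> meets z a b (odd b) B\<^sub>2 \<and>
      (\<forall>B\<in>\<B> - {B\<^sub>1, B\<^sub>2}. \<forall>p. meets z a b p B)"
    unfolding zigzag_clique_def by (elim conjE bexE) (intro that conjI)
  moreover from B have "meets z a b p B" if "B \<in> \<B> - {B\<^sub>1, B\<^sub>2}" for B p
    using that by blast
  ultimately show thesis
    using that by presburger
qed

lemma meets_mono: "meets z a' b p B \<Longrightarrow> a \<le> a' \<Longrightarrow> B \<subseteq> C \<Longrightarrow> meets z a b p C"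
  by (fastforce simp: meets_def)

lemma zigzag_clique_meets:
  assumes "zigzag_clique V E a b z \<sigma> \<B>" "B \<in> \<B>"
  shows "\<exists>p. meets z a b p B"
  using assms unfolding zigzag_clique_def by blast

text \<open>\<open>K\<close> contains the first term and possibly the second. A term in
  \<open>K\<close> is adjacent to every later term of the other index parity, and such a later term
  outside \<open>K\<close> then sees both sides of \<open>K\<close>. The number of terms in
  \<open>K\<close> and the parity of the number of remaining terms decide whether \<open>K\<close>
  is inserted or merged.\<close>

lemma zigzag_clique_step:
  assumes E: "sym E" and K: "K \<noteq> {}" "K \<subseteq> V" "cut_connected E \<sigma> K"
    and joined: "\<And>u v. v \<in> V - K \<Longrightarrow> u \<in> K \<Longrightarrow> (u, v) \<in> E \<Longrightarrow> joined_to_both_sides E \<sigma> K v"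
    and z: "\<And>i j. i \<in> {a..b} \<Longrightarrow> j \<in> {a..b} \<Longrightarrow> odd i \<noteq> odd j \<Longrightarrow> (z i, z j) \<in> E"
    and a: "a < b" "z a \<in> K"
    and zV: "\<And>i. i \<in> {a..b} \<Longrightarrow> z i \<in> V"
    and rest: "z (Suc a) \<notin> K \<Longrightarrow> \<exists>\<tau> \<B>. zigzag_clique (V - K) E (Suc a) b z \<tau> \<B>"
      "z (Suc a) \<in> K \<Longrightarrow> Suc a < b \<Longrightarrow> \<exists>\<tau> \<B>. zigzag_clique (V - K) E (Suc (Suc a)) b z \<tau> \<B>"
    and neq: "z a \<noteq> z (Suc a)"
  shows "\<exists>\<tau> \<B>. zigzag_clique V E a b z \<tau> \<B>"
proof -
  \<comment> \<open>The signs on \<open>K\<close> and on the later branch sets come from independent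
    sources. Since the sets are disjoint, \<rho> can follow \<sigma> on \<open>K\<close> and \<tau>
    elsewhere.\<close>
  have glue: "\<exists>\<rho>. odd_clique E \<rho> \<B> \<and> cut_connected E \<rho> K \<and> K \<inter> \<Union>\<B> = {} \<and>
      (\<forall>v. joined_to_both_sides E \<sigma> K v \<longrightarrow> joined_to_both_sides E \<rho> K v)"
    if \<B>: "zigzag_clique (V - K) E a' b z \<tau> \<B>" for a' \<tau> \<B>
  proof -
    define \<rho> where "\<rho> x = (if x \<in> K then \<sigma> x else \<tau> x)" for x
    have \<rho>: "\<rho> x = \<sigma> x" if "x \<in> K" for x
      using that by (simp add: \<rho>_def)
    have disj: "K \<inter> \<Union>\<B> = {}"
      using \<B> by (auto simp: zigzag_clique_def)
    have "odd_clique E \<rho> \<B>"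
      by (rule odd_clique_cong[of _ \<tau>]) (use \<B> disj in \<open>auto simp: zigzag_clique_def \<rho>_def\<close>)
    moreover have "cut_connected E \<rho> K"
      using cut_connected_cong[of K \<rho> \<sigma>, OF \<rho>] K by simp
    moreover have "joined_to_both_sides E \<rho> K v" if "joined_to_both_sides E \<sigma> K v" for v
      using that \<rho> unfolding joined_to_both_sides_def by metis
    ultimately show ?thesis
      using disj by blast
  qed
  have attach: "\<exists>v\<in>B. joined_to_both_sides E \<sigma> K v"
    if "meets z a' b p B" "B \<subseteq> V - K" "j \<in> {a..b}" "z j \<in> K" "odd j \<noteq> p" "a \<le> a'" for a' p B j
  proof -
    from that(1) obtain i where i: "i \<in> {a'..b}" "odd i = p" "z i \<in> B"
      unfolding meets_def by blast
    then have "(z j, z i) \<in> E"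
      using z[of j i] that by auto
    then show ?thesis
      using joined[of "z i" "z j"] i that by blast
  qed
  have meets_a: "meets z a b (odd a) K"
    using a by (force simp: meets_def)
  show ?thesis
  proof (cases "z (Suc a) \<in> K")
    case True
    have meets_Suc: "meets z a b (even a) K"
      unfolding meets_def by (rule bexI[of _ "Suc a"]) (use True a in auto)
    have meets_K: "meets z a b p K" for p
      using meets_a meets_Suc by (cases "p = odd a") auto
    show ?thesis
    proof (cases "b = Suc a")
      case b: True
      \<comment> \<open>No terms remain, but two branch sets are required. The two terms themselves
        serve as singletons, and a constant sign makes the edge between them an equal-sign
        arc.\<close>
      let ?\<B> = "{{z a}, {z b}}"
      have zab: "(z a, z b) \<in> E" "(z b, z a) \<in> E"
        using z[of a b] z[of b a] b by auto
      have "odd_clique E (\<lambda>_. True) ?\<B>"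
        using zab neq b
        by (auto simp: odd_clique_def cut_connected_singleton pairwise_insert)
      moreover have "card ?\<B> = 2"
        using neq b by simp
      moreover have "meets z a b (odd a) {z a}" "meets z a b (odd b) {z b}"
        using a by (auto simp: meets_def)
      moreover have "\<Union>?\<B> \<subseteq> V"
        using zV b by auto
      ultimately have "zigzag_clique V E a b z (\<lambda>_. True) ?\<B>"
        unfolding zigzag_clique_def using b neq by auto
      then show ?thesis by blast
    next
      case False
      then obtain \<tau> \<B> where \<B>: "zigzag_clique (V - K) E (Suc (Suc a)) b z \<tau> \<B>"
        using rest(2) True a by auto
      obtain \<rho> where \<rho>: "odd_clique E \<rho> \<B>" "cut_connected E \<rho> K" "K \<inter> \<Union>\<B> = {}"
        "\<And>v. joined_to_both_sides E \<sigma> K v \<Longrightarrow> joined_to_both_sides E \<rho> K v"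
        using glue[OF \<B>] by blast
      \<comment> \<open>Every member contains a later term of some parity, and \<open>K\<close> has
        a term of the opposite one. So \<open>K\<close> can be linked to all members: two more
        terms, one more set.\<close>
      have "\<exists>v\<in>B. joined_to_both_sides E \<rho> K v" if B: "B \<in> \<B>" for B
      proof -
        obtain p where p: "meets z (Suc (Suc a)) b p B"
          using zigzag_clique_meets[OF \<B> B] by blast
        have sub: "B \<subseteq> V - K"
          using \<B> B by (auto simp: zigzag_clique_def)
        obtain j where "j \<in> {a..b}" "z j \<in> K" "odd j \<noteq> p"
          using meets_K[of "\<not> p"] by (auto simp: meets_def)
        then have "\<exists>v\<in>B. joined_to_both_sides E \<sigma> K v"
          using attach[OF p sub] by auto
        then show ?thesis
          using \<rho>(4) by blast
      qed
      then have clique: "odd_clique E \<rho> (insert K \<B>)"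
        using odd_clique_insert[OF E \<rho>(1,2) K(1) \<rho>(3)] by blast
      have "K \<notin> \<B>"
        using \<rho>(3) K(1) by blast
      then have card: "card (insert K \<B>) = (b + 1 - a) div 2 + 1"
        using \<B> a False by (auto simp: zigzag_clique_def)
      obtain B1 B2 where B12: "B1 \<in> \<B>" "B2 \<in> \<B>" "B1 = B2 \<longleftrightarrow> odd a = odd b"
        "meets z (Suc (Suc a)) b (odd a) B1" "meets z (Suc (Suc a)) b (odd b) B2"
        "\<And>B p. B \<in> \<B> - {B1, B2} \<Longrightarrow> meets z (Suc (Suc a)) b p B"
        by (rule zigzag_cliqueE[OF \<B>, unfolded even_Suc not_not]) (rule that)
      have meets_up: "meets z a b p B" if "meets z (Suc (Suc a)) b p B" for p B
        by (rule meets_mono[OF that]) auto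
      \<comment> \<open>Passing from \<open>a + 2\<close> to \<open>a\<close> keeps the parity, so
        \<open>B1\<close> and \<open>B2\<close> remain the exceptional sets, while \<open>K\<close>
        meets both parities.\<close>
      have "zigzag_clique V E a b z \<rho> (insert K \<B>)"
      proof (rule zigzag_cliqueI[OF _ _ clique card])
        show "B1 = B2 \<longleftrightarrow> odd a = odd b" by (fact B12(3))
        show "finite (insert K \<B>)" "\<Union>(insert K \<B>) \<subseteq> V"
          using \<B> K(2) by (auto simp: zigzag_clique_def)
        show "meets z a b p B" if "B \<in> insert K \<B> - {B1, B2}" for B p
          using that meets_K meets_up[OF B12(6)] by blast
      qed (use B12 meets_up in auto)
      then show ?thesis by blast
    qed
  next
    case False
    then obtain \<tau> \<B> where \<B>: "zigzag_clique (V - K) E (Suc a) b z \<tau> \<B>"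
      using rest(1) by auto
    obtain \<rho> where \<rho>: "odd_clique E \<rho> \<B>" "cut_connected E \<rho> K" "K \<inter> \<Union>\<B> = {}"
      "\<And>v. joined_to_both_sides E \<sigma> K v \<Longrightarrow> joined_to_both_sides E \<rho> K v"
      using glue[OF \<B>] by blast
    obtain B1 B2 where B12: "B1 \<in> \<B>" "B2 \<in> \<B>" "B1 = B2 \<longleftrightarrow> even a = odd b"
      "meets z (Suc a) b (even a) B1" "meets z (Suc a) b (odd b) B2"
      "\<And>B p. B \<in> \<B> - {B1, B2} \<Longrightarrow> meets z (Suc a) b p B"
      by (rule zigzag_cliqueE[OF \<B>, unfolded even_Suc not_not]) (rule that)
    have attach_a: "\<exists>v\<in>B. joined_to_both_sides E \<rho> K v"
      if "B \<in> \<B>" "meets z (Suc a) b (even a) B" for B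
    proof -
      have "B \<subseteq> V - K"
        using \<B> that by (auto simp: zigzag_clique_def)
      then show ?thesis
        using attach[OF that(2), of a] a \<rho>(4) by fastforce
    qed
    have K_notin: "K \<notin> \<B>"
      using \<rho>(3) K(1) by blast
    have meets_up: "meets z a b p B" if "meets z (Suc a) b p B" for p B
      by (rule meets_mono[OF that]) auto
    show ?thesis
    proof (cases "odd a = odd b")
      case same: True
      \<comment> \<open>The number of remaining terms is even, so \<open>B2\<close> is only known to
        have a term of the parity of \<open>a\<close>, which gives no arc to \<open>z a\<close>.
        Merging \<open>K\<close> into \<open>B1\<close>, which has a term of the other parity, keeps
        the size as required. The merged set meets both parities, and \<open>B2\<close> is left as
        the single exceptional set.\<close>
      let ?\<C> = "insert (K \<union> B1) (\<B> - {B1})"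
      have clique: "odd_clique E \<rho> ?\<C>"
        using odd_clique_merge[OF E \<rho>(1,2,3) B12(1) attach_a[OF B12(1,4)]] .
      have "K \<union> B1 \<notin> \<B>"
        using \<rho>(3) K(1) by blast
      moreover have "finite \<B>" "card \<B> = (b - a) div 2 + 1"
        using \<B> by (auto simp: zigzag_clique_def)
      moreover have "(b - a) div 2 = (b + 1 - a) div 2"
        using same a by presburger
      ultimately have card: "finite ?\<C>" "card ?\<C> = (b + 1 - a) div 2 + 1"
        using B12(1) by (simp_all add: card.insert_remove)
      have meets_new: "meets z a b p (K \<union> B1)" for p
      proof (cases "p = odd a")
        case True
        then show ?thesis using meets_mono[OF meets_a] by blast
      next
        case False
        then have "p = even a" by auto
        then show ?thesis using meets_mono[OF B12(4), of a "K \<union> B1"] by auto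
      qed
      have B2: "B2 \<in> ?\<C>" "meets z a b (odd b) B2"
        using B12 same meets_up by auto
      have "zigzag_clique V E a b z \<rho> ?\<C>"
      proof (rule zigzag_cliqueI[OF card(1) _ clique card(2) B2(1) B2(1)])
        show "\<Union>?\<C> \<subseteq> V"
          using \<B> B12(1) K(2) by (auto simp: zigzag_clique_def)
        show "meets z a b p B" if "B \<in> ?\<C> - {B2, B2}" for B p
          using that meets_new meets_up[OF B12(6)] by blast
      qed (use B2 same in simp_all)
      then show ?thesis by blast
    next
      case diff: False
      then have eq: "B1 = B2" "odd b = even a"
        using B12(3) by auto
      \<comment> \<open>The number of remaining terms is odd, so the single exceptional set, like
        every other member, has a term of parity opposite to \<open>a\<close>. Hence
        \<open>K\<close> becomes a new member, and \<open>K\<close> and \<open>B2\<close> are the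
        two exceptional sets.\<close>
      have attach_all: "\<exists>v\<in>B. joined_to_both_sides E \<rho> K v" if "B \<in> \<B>" for B
        using attach_a[OF that] B12(4) B12(6)[of B] eq that by blast
      have clique: "odd_clique E \<rho> (insert K \<B>)"
        using odd_clique_insert[OF E \<rho>(1,2) K(1) \<rho>(3) attach_all] .
      have "finite \<B>" "card \<B> = (b - a) div 2 + 1"
        using \<B> by (auto simp: zigzag_clique_def)
      moreover have "(b + 1 - a) div 2 = (b - a) div 2 + 1"
        using diff a by presburger
      ultimately have card: "finite (insert K \<B>)" "card (insert K \<B>) = (b + 1 - a) div 2 + 1"
        using K_notin by simp_all
      have "zigzag_clique V E a b z \<rho> (insert K \<B>)"
      proof (rule zigzag_cliqueI[OF card(1) _ clique card(2)])
        show "\<Union>(insert K \<B>) \<subseteq> V"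
          using \<B> K(2) by (auto simp: zigzag_clique_def)
        show "K = B2 \<longleftrightarrow> odd a = odd b"
          using B12(2) K_notin diff by blast
        show "meets z a b (odd a) K"
          by (fact meets_a)
        show "meets z a b (odd b) B2"
          by (rule meets_up[OF B12(5)])
        show "meets z a b p B" if "B \<in> insert K \<B> - {K, B2}" for B p
          using that eq meets_up[OF B12(6)] by blast
      qed (use B12(2) in simp_all)
      then show ?thesis by blast
    qed
  qed
qed

text \<open>Induction on \<open>V\<close>: a maximal piece \<open>K\<close> takes the two lowest
  colours, and the colouring of \<open>V - K\<close> is shifted above them. The claim covers all
  index intervals because the recursion drops initial terms without renumbering.\<close>

lemma ex_coloring_zigzag_clique:
  assumes "finite V" and E: "sym E" "irrefl E"
  shows "\<exists>c :: 'a \<Rightarrow> nat. (\<forall>u\<in>V. \<forall>v\<in>V. (u, v) \<in> E \<longrightarrow> c u \<noteq> c v) \<and>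
    (\<forall>a b z. a \<le> b \<longrightarrow> zigzag_on V E c a b z \<longrightarrow> (\<exists>\<sigma> \<B>. zigzag_clique V E a b z \<sigma> \<B>))"
  using assms(1)
proof (induction V rule: finite_psubset_induct)
  case (psubset V)
  show ?case
  proof (cases "V = {}")
    case True
    then show ?thesis by (auto simp: zigzag_on_def)
  next
    case False
    obtain K \<sigma> where K: "K \<subseteq> V" "K \<noteq> {}" "cut_connected E \<sigma> K"
      "\<And>u v. u \<in> K \<Longrightarrow> v \<in> K \<Longrightarrow> (u, v) \<in> E \<Longrightarrow> \<sigma> u \<noteq> \<sigma> v"
      "\<And>u v. v \<in> V - K \<Longrightarrow> u \<in> K \<Longrightarrow> (u, v) \<in> E \<Longrightarrow> joined_to_both_sides E \<sigma> K v"
      using ex_maximal_connected_bipartite[OF psubset.hyps False E] by metis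
    have "V - K \<subset> V"
      using K(1,2) by blast
    from psubset.IH[OF this] obtain c' :: "'a \<Rightarrow> nat" where
      proper: "\<And>u v. u \<in> V - K \<Longrightarrow> v \<in> V - K \<Longrightarrow> (u, v) \<in> E \<Longrightarrow> c' u \<noteq> c' v" and
      clique: "\<And>a b z. a \<le> b \<Longrightarrow> zigzag_on (V - K) E c' a b z \<Longrightarrow>
        \<exists>\<sigma> \<B>. zigzag_clique (V - K) E a b z \<sigma> \<B>"
      by blast
    define c where "c x = (if x \<in> K then if \<sigma> x then 0 else 1 else c' x + 2)" for x
    have cK: "c x < 2 \<longleftrightarrow> x \<in> K" for x
      by (simp add: c_def)
    have "c u \<noteq> c v" if "u \<in> V" "v \<in> V" "(u, v) \<in> E" for u v
      using K(4)[of u v] proper[of u v] that by (auto simp: c_def)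
    moreover have "\<exists>\<sigma> \<B>. zigzag_clique V E a b z \<sigma> \<B>"
      if ab: "a \<le> b" and zz: "zigzag_on V E c a b z" for a b z
    proof -
      have z: "\<And>i. i \<in> {a..b} \<Longrightarrow> z i \<in> V"
        "\<And>i j. i \<in> {a..b} \<Longrightarrow> j \<in> {a..b} \<Longrightarrow> odd i \<noteq> odd j \<Longrightarrow> (z i, z j) \<in> E"
        "\<And>i j. i \<in> {a..b} \<Longrightarrow> j \<in> {a..b} \<Longrightarrow> i < j \<Longrightarrow> c (z i) < c (z j)"
        using zz by (auto simp: zigzag_on_def strict_mono_on_def)
      \<comment> \<open>Colours increase along the zigzag and \<open>K\<close> has the lowest ones,
        so after the first term outside \<open>K\<close> the zigzag stays in
        \<open>V - K\<close>.\<close>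
      have rest: "\<exists>\<sigma> \<B>. zigzag_clique (V - K) E a' b z \<sigma> \<B>"
        if a': "a \<le> a'" "a' \<le> b" "z a' \<notin> K" for a'
      proof -
        have notK: "z i \<notin> K" if "i \<in> {a'..b}" for i
        proof (cases "i = a'")
          case True
          then show ?thesis using a' by simp
        next
          case False
          then have "c (z a') < c (z i)"
            using z(3)[of a' i] a' that by auto
          then show ?thesis
            using a'(3) cK[of "z i"] cK[of "z a'"] by linarith
        qed
        have "c' (z i) < c' (z j)" if "i \<in> {a'..b}" "j \<in> {a'..b}" "i < j" for i j
          using z(3)[of i j] notK[OF that(1)] notK[OF that(2)] that a'(1) by (auto simp: c_def)
        then have "zigzag_on (V - K) E c' a' b z"
          unfolding zigzag_on_def strict_mono_on_def using z(1,2) notK a'(1) by auto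
        then show ?thesis
          using clique a'(2) by blast
      qed
      show ?thesis
      proof (cases "z a \<in> K")
        case False
        then obtain \<tau> \<B> where "zigzag_clique (V - K) E a b z \<tau> \<B>"
          using rest ab by blast
        then have "zigzag_clique V E a b z \<tau> \<B>"
          by (auto simp: zigzag_clique_def)
        then show ?thesis by blast
      next
        case zaK: True
        show ?thesis
        proof (cases "a = b")
          case True
          have "odd_clique E \<sigma> {{z a}}"
            by (simp add: odd_clique_def cut_connected_singleton)
          then have "zigzag_clique V E a b z \<sigma> {{z a}}"
            using z(1) True by (auto simp: zigzag_clique_def meets_def)
          then show ?thesis by blast
        next
          case False
          then have ab': "a < b"
            using ab by simp
          \<comment> \<open>Three strictly increasing colours cannot all be below 2, so
            \<open>K\<close> contains at most two terms.\<close>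
          have far: "z (Suc (Suc a)) \<notin> K" if "Suc a < b"
            using z(3)[of a "Suc a"] z(3)[of "Suc a" "Suc (Suc a)"] that cK[of "z (Suc (Suc a))"]
            by fastforce
          have neq: "z a \<noteq> z (Suc a)"
            using z(3)[of a "Suc a"] ab' by auto
          show ?thesis
          proof (rule zigzag_clique_step[where K = K and V = V and \<sigma> = \<sigma>])
            show "\<exists>\<tau> \<B>. zigzag_clique (V - K) E (Suc a) b z \<tau> \<B>" if "z (Suc a) \<notin> K"
              using rest[of "Suc a"] ab' that by simp
            show "\<exists>\<tau> \<B>. zigzag_clique (V - K) E (Suc (Suc a)) b z \<tau> \<B>" if "Suc a < b"
              using rest[of "Suc (Suc a)"] far that by simp
          qed (fact E(1) K(1,2,3,5) z(1,2) ab' zaK neq)+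
        qed
      qed
    qed
    ultimately show ?thesis by blast
  qed
qed

section \<open>Odd minors\<close>

lemma digraph_iso_complete_graph:
  assumes "finite (pverts H)"
    and "parcs H = {(A, B). A \<in> pverts H \<and> B \<in> pverts H \<and> A \<noteq> B}"
  shows "digraph_iso (with_proj H) (with_proj (complete_graph (card (pverts H))))"
proof -
  obtain h where h: "bij_betw h (pverts H) {..<card (pverts H)}"
    using ex_bij_betw_finite_nat[OF assms(1)] by (auto simp: atLeast0LessThan)
  then have inj: "inj_on h (pverts H)" and img: "h ` pverts H = {..<card (pverts H)}"
    by (auto simp: bij_betw_def)
  \<comment> \<open>An arc of a pair digraph is the pair of its ends, so the vertex bijection
    \<open>h\<close> acts on arcs as \<open>map_prod h h\<close>.\<close>
  define f where "f = \<lparr> iso_verts = h, iso_arcs = map_prod h h, iso_head = snd, iso_tail = fst \<rparr>"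
  have "inj_on (map_prod h h) (parcs H)"
    using map_prod_inj_on[OF inj inj] by (rule inj_on_subset) (auto simp: assms(2))
  then have "pre_digraph.digraph_isomorphism (with_proj H) f"
    using inj
    by (auto simp: pre_digraph.digraph_isomorphism_def f_def assms(2) intro!: wf_digraph.intro)
  moreover have "map_prod h h ` parcs H = parcs (complete_graph (card (pverts H)))"
  proof (intro subset_antisym subsetI)
    fix e assume "e \<in> map_prod h h ` parcs H"
    then show "e \<in> parcs (complete_graph (card (pverts H)))"
      using img inj by (auto simp: assms(2) complete_graph_def inj_on_eq_iff)
  next
    fix e assume e: "e \<in> parcs (complete_graph (card (pverts H)))"
    obtain i j where ij: "e = (i, j)" by fastforce
    with e have "i \<in> h ` pverts H" "j \<in> h ` pverts H" "i \<noteq> j"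
      unfolding img by (auto simp: complete_graph_def)
    then show "e \<in> map_prod h h ` parcs H"
      unfolding ij by (force simp: assms(2))
  qed
  then have "with_proj (complete_graph (card (pverts H))) = app_iso f (with_proj H)"
    using img by (simp add: app_iso_def f_def with_proj_def) (simp add: complete_graph_def)
  ultimately show ?thesis
    unfolding digraph_iso_def by blast
qed

text \<open>In a suitable subgraph the cut between positive and negative vertices consists exactly
  of the sign-changing arcs inside the branch sets. Contracting it turns each branch set into one
  vertex, and the equal-sign arcs make these vertices pairwise adjacent.\<close>

lemma odd_minor_complete_graph:
  assumes G: "pair_graph G" and \<B>: "finite \<B>" "\<Union>\<B> \<subseteq> pverts G" "odd_clique (parcs G) \<sigma> \<B>"
  shows "odd_minor (complete_graph (card \<B>)) G"
proof -
  interpret G: pair_graph G by fact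
  have symG: "sym (parcs G)"
    using G.pair_sym_arcs by (simp add: symmetric_def)
  define U where "U = \<Union>\<B>"
  \<comment> \<open>\<open>F\<close> will be contracted, and \<open>M\<close> supplies the
    adjacencies. Sign-changing arcs between different branch sets would lie in the cut and fuse
    these sets, so \<open>G'\<close> leaves them out.\<close>
  define F where "F = (\<Union>B\<in>\<B>. cut_within (parcs G) \<sigma> B)"
  define M where "M = {(u, v) \<in> parcs G. u \<in> U \<and> v \<in> U \<and> \<sigma> u = \<sigma> v}"
  define G' where "G' = \<lparr> pverts = U, parcs = F \<union> M \<rparr>"
  define S where "S = {u \<in> U. \<sigma> u}"
  define H where "H = contract G' (cut_arcs G' S)"
  have FM: "F \<subseteq> parcs G" "M \<subseteq> parcs G" "F \<subseteq> U \<times> U" "M \<subseteq> U \<times> U"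
    by (auto simp: F_def M_def U_def cut_within_def)
  have "sym (F \<union> M)"
    using symG by (auto simp: F_def M_def cut_within_def sym_def)
  moreover have "finite U" "finite (F \<union> M)"
    using finite_subset[OF \<B>(2) G.pair_finite_verts] finite_subset[OF _ G.pair_finite_arcs] FM
    by (auto simp: U_def)
  ultimately have G': "pair_graph G'"
    using FM G.pair_no_loops by unfold_locales (auto simp: G'_def symmetric_def)
  have sub: "subgraph (with_proj G') (with_proj G)"
  proof -
    interpret G': pair_graph G' by fact
    show ?thesis
      using FM \<B>(2) G.wf_digraph_axioms G'.wf_digraph_axioms
      by (auto simp: subgraph_def compatible_def G'_def U_def)
  qed
  have cut: "cut_arcs G' S = F"
    by (auto simp: cut_arcs_def G'_def S_def F_def M_def U_def cut_within_def)
  have dis: "disjoint \<B>" and conn: "\<And>B. B \<in> \<B> \<Longrightarrow> cut_connected (parcs G) \<sigma> B"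
    and ne: "{} \<notin> \<B>"
    using \<B>(3) by (auto simp: odd_clique_def)
  have same: "A = B" if "A \<in> \<B>" "B \<in> \<B>" "x \<in> A" "x \<in> B" for A B x
    using dis that by (meson disjnt_iff pairwiseD)
  \<comment> \<open>Each arc of \<open>F\<close> lies inside one branch set and the sets are
    disjoint, so paths in \<open>F\<close> never leave a set. Within a set, cut-connectedness
    reaches every vertex.\<close>
  have cls: "F\<^sup>* `` {u} = B" if B: "B \<in> \<B>" "u \<in> B" for B u
  proof (intro subset_antisym subsetI)
    fix v assume "v \<in> F\<^sup>* `` {u}"
    then have "(u, v) \<in> F\<^sup>*" by simp
    then show "v \<in> B"
    proof induction
      case base
      show ?case using B by simp
    next
      case (step x y)
      then obtain A where "A \<in> \<B>" "x \<in> A" "y \<in> A"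
        by (auto simp: F_def cut_within_def)
      then show ?case
        using same[OF _ B(1), of A x] step by blast
    qed
  next
    fix v assume "v \<in> B"
    then have "(u, v) \<in> (cut_within (parcs G) \<sigma> B)\<^sup>*"
      using conn B unfolding cut_connected_def by blast
    moreover have "cut_within (parcs G) \<sigma> B \<subseteq> F"
      using B by (auto simp: F_def)
    ultimately show "v \<in> F\<^sup>* `` {u}"
      using rtrancl_mono by blast
  qed
  have "U // F\<^sup>* = \<B>"
  proof (intro subset_antisym subsetI)
    fix A assume "A \<in> U // F\<^sup>*"
    then show "A \<in> \<B>"
      using cls by (auto simp: quotient_def U_def)
  next
    fix B assume B: "B \<in> \<B>"
    then obtain u where "u \<in> B"
      using ne by (metis ex_in_conv)
    then show "B \<in> U // F\<^sup>*"
      using cls[OF B] B unfolding quotient_def U_def by blast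
  qed
  then have pv: "pverts H = \<B>"
    by (simp add: H_def contract_def cut) (simp add: G'_def)
  have "\<exists>u\<in>A. \<exists>v\<in>B. (u, v) \<in> parcs G'" if AB: "A \<in> \<B>" "B \<in> \<B>" "A \<noteq> B" for A B
  proof -
    obtain u v where "u \<in> A" "v \<in> B" "(u, v) \<in> parcs G" "\<sigma> u = \<sigma> v"
      using \<B>(3) AB unfolding odd_clique_def by blast
    then show ?thesis
      using AB by (auto simp: G'_def M_def U_def)
  qed
  then have "parcs H = {(A, B). A \<in> pverts H \<and> B \<in> pverts H \<and> A \<noteq> B}"
    using pv by (auto simp: H_def contract_def)
  then have "digraph_iso (with_proj H) (with_proj (complete_graph (card \<B>)))"
    using digraph_iso_complete_graph[of H] \<B>(1) pv by simp
  moreover have "S \<subseteq> pverts G'"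
    by (auto simp: S_def G'_def)
  ultimately show ?thesis
    unfolding odd_minor_def H_def using G' sub by blast
qed

theorem theorem1:
  fixes G :: "'a pair_pre_digraph" and t :: nat
  assumes "pair_graph G"
    and "t > 0"
    and "zig G \<ge> t"
  shows "odd_minor (complete_graph (t div 2 + 1)) G"
proof -
  interpret pair_graph G by fact
  have sym: "sym (parcs G)"
    using pair_sym_arcs by (simp add: symmetric_def)
  have irr: "irrefl (parcs G)"
    using pair_no_loops by (force simp: irrefl_def)
  obtain c :: "'a \<Rightarrow> nat" where
    c: "\<And>u v. u \<in> pverts G \<Longrightarrow> v \<in> pverts G \<Longrightarrow> (u, v) \<in> parcs G \<Longrightarrow> c u \<noteq> c v" and
    clique: "\<And>a b z. a \<le> b \<Longrightarrow> zigzag_on (pverts G) (parcs G) c a b z \<Longrightarrow>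
      \<exists>\<sigma> \<B>. zigzag_clique (pverts G) (parcs G) a b z \<sigma> \<B>"
    using ex_coloring_zigzag_clique[OF pair_finite_verts sym irr] by blast
  \<comment> \<open>This particular colouring has a zigzag of length \<open>k\<close>, its maximum,
    and \<open>k\<close> is at least \<open>zig G\<close>, hence at least \<open>t\<close>.\<close>
  define k where "k = max_zigzag G c"
  have "proper_coloring G c"
    using c by (auto simp: proper_coloring_def dest: wellformed')
  then have tk: "t \<le> k"
    using zig_le[of G c] assms(3) by (simp add: k_def)
  have "k \<in> {k. \<exists>z. zigzag G c k z}"
    unfolding k_def max_zigzag_def
    by (rule Max_in[OF finite_zigzag_lengths[OF assms(1)]]) (use zigzag_0 in blast)
  then obtain z where z: "zigzag G c k z"
    by blast
  \<comment> \<open>\<open>zigzag\<close> gives arcs from odd to even indices; the reverse ones come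
    from symmetry. Truncating to the first \<open>t\<close> terms makes the size of the clique
    exactly \<open>(t + 1 - 1) div 2 + 1\<close>.\<close>
  have "(z i, z j) \<in> parcs G" if "i \<in> {1..t}" "j \<in> {1..t}" "odd i \<noteq> odd j" for i j
  proof -
    have ij: "i \<in> {1..k}" "j \<in> {1..k}"
      using that tk by auto
    show ?thesis
    proof (cases "odd i")
      case True
      then show ?thesis using z ij that(3) unfolding zigzag_def by blast
    next
      case False
      then have "(z j, z i) \<in> parcs G"
        using z ij that(3) unfolding zigzag_def by blast
      then show ?thesis using sym by (rule symD[rotated])
    qed
  qed
  then have "zigzag_on (pverts G) (parcs G) c 1 t z"
    using z tk unfolding zigzag_def zigzag_on_def strict_mono_on_def by auto
  then obtain \<sigma> \<B> where "zigzag_clique (pverts G) (parcs G) 1 t z \<sigma> \<B>"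
    using clique[of 1 t z] assms(2) by auto
  then show ?thesis
    using odd_minor_complete_graph[OF assms(1), of \<B> \<sigma>] by (auto simp: zigzag_clique_def)
qed

end
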